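(* Let $0\le a\le1$ and let $E$ be a compact subset of $\mathbb{T}=\mathbb{R}/\mathbb{Z}$ of Lebesgue measure zero which supports a Borel probability measure $\mu$ such that, for some constant $K>0$, $|\hat\mu(n)|\le K|n|^{-a}$ for all integers $n\neq0$. If $f$ belongs to the Sobolev space $H^p(\mathbb{T})$ for some $p>(1-a)/2$, then the Fourier series $\sum_{n\in\mathbb{Z}}\hat f(n)\exp(2\pi i n t)$ of $f$ converges for $\mu$-almost every $t\in E$.
   Context: $\hat\mu(n)=\int_{\mathbb{T}}\exp(2\pi i n x)\,d\mu(x)$, and $\hat f(n)=\int_{\mathbb{T}}f(x)\exp(-2\pi i n x)\,dx$. The Sobolev space $H^p(\mathbb{T})$ consists of the $f\in L^2(\mathbb{T})$ with $\sum_{n\in\mathbb{Z}}|\hat f(n)|^2(1+n^2)^p<\infty$. Convergence of the Fourier series means convergence of the symmetric partial sums $\sum_{|n|\le N}\hat f(n)\exp(2\pi i n t)$ as $N\to\infty$. *)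

theory Defs
  imports "HOL-Probability.Probability"
begin

definition circle_rel :: "real \<Rightarrow> real \<Rightarrow> bool" where
  "circle_rel x y \<longleftrightarrow> x - y \<in> \<int>"

lemma equivp_circle_rel: "equivp circle_rel"
proof (rule equivpI)
  show "reflp circle_rel"
    by (auto simp: reflp_def circle_rel_def)
  show "symp circle_rel"
    by (metis Ints_minus circle_rel_def minus_diff_eq sympI)
  show "transp circle_rel"
  proof (rule transpI)
    fix x y z assume "circle_rel x y" "circle_rel y z"
    then have "(x - y) + (y - z) \<in> \<int>"
      unfolding circle_rel_def by (rule Ints_add)
    then show "circle_rel x z" by (simp add: circle_rel_def)
  qed
qed

quotient_type circle = real / circle_rel
  morphisms rep_circle to_circle
  by (rule equivp_circle_rel)

(* The quotient topology of R / Z. *)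
instantiation circle :: topological_space
begin

definition open_circle :: "circle set \<Rightarrow> bool" where
  "open_circle U \<longleftrightarrow> open (to_circle -` U)"

instance
proof
  show "open (UNIV :: circle set)" by (simp add: open_circle_def)
next
  fix S T :: "circle set" assume "open S" "open T"
  then show "open (S \<inter> T)" by (auto simp: open_circle_def)
next
  fix K :: "circle set set" assume "\<forall>S\<in>K. open S"
  then show "open (\<Union>K)" by (auto simp: open_circle_def vimage_Union)
qed

end

lift_definition circle_exp :: "int \<Rightarrow> circle \<Rightarrow> complex"
  is "\<lambda>n x. exp (2 * complex_of_real pi * \<i> * of_int n * complex_of_real x)"
proof -
  fix n :: int and x y :: real
  assume "circle_rel x y"
  then obtain k :: int where "x - y = of_int k" by (auto simp: circle_rel_def elim: Ints_cases)
  then have x: "x = y + of_int k" by simp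
  show "exp (2 * complex_of_real pi * \<i> * of_int n * complex_of_real x) =
        exp (2 * complex_of_real pi * \<i> * of_int n * complex_of_real y)"
    unfolding exp_eq x by (rule exI[of _ "n * k"]) (simp add: algebra_simps)
qed

lemma circle_exp_to_circle:
  "circle_exp n (to_circle x) = exp (2 * complex_of_real pi * \<i> * of_int n * complex_of_real x)"
  by (rule circle_exp.abs_eq)

lemma continuous_on_to_circle: "continuous_on UNIV to_circle"
  by (simp add: continuous_on_open_vimage open_circle_def)

lemma continuous_on_circle_exp: "continuous_on UNIV (circle_exp n)"
proof -
  have c: "continuous_on UNIV (\<lambda>x. circle_exp n (to_circle x))"
    unfolding circle_exp_to_circle by (intro continuous_intros)
  have "open (circle_exp n -` B)" if "open B" for B
  proof -
    have "open ((\<lambda>x. circle_exp n (to_circle x)) -` B)"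
      using that c by (rule open_vimage)
    also have "(\<lambda>x. circle_exp n (to_circle x)) -` B = to_circle -` (circle_exp n -` B)"
      by auto
    finally show ?thesis by (simp only: open_circle_def)
  qed
  then show ?thesis
    by (simp add: continuous_on_open_vimage)
qed

lemma inj_circle_exp: "inj (circle_exp 1)"
proof (rule injI)
  fix s t assume "circle_exp 1 s = circle_exp 1 t"
  then show "s = t"
  proof transfer
    fix x y :: real
    assume "exp (2 * complex_of_real pi * \<i> * of_int 1 * complex_of_real x) =
            exp (2 * complex_of_real pi * \<i> * of_int 1 * complex_of_real y)"
    then obtain k :: int where
      "2 * complex_of_real pi * \<i> * complex_of_real x =
       2 * complex_of_real pi * \<i> * complex_of_real y + of_int (2 * k) * of_real pi * \<i>"
      unfolding exp_eq by auto
    then have "2 * pi * x = 2 * pi * y + 2 * k * pi"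
      by (auto simp: complex_eq_iff)
    then have "2 * pi * (x - y) = 2 * pi * of_int k"
      by (simp add: algebra_simps)
    then have "x - y = of_int k" by simp
    then show "circle_rel x y" by (simp add: circle_rel_def)
  qed
qed

(* In particular compact subsets of the circle are closed, hence Borel. *)
instance circle :: t2_space
proof
  fix s t :: circle assume "s \<noteq> t"
  then have "circle_exp 1 s \<noteq> circle_exp 1 t" by (simp add: inj_eq[OF inj_circle_exp])
  from hausdorff[OF this] obtain U V where
    UV: "open U" "open V" "circle_exp 1 s \<in> U" "circle_exp 1 t \<in> V" "U \<inter> V = {}"
    by (elim exE conjE)
  have "open (circle_exp 1 -` U)" "open (circle_exp 1 -` V)"
    using UV(1,2) by (simp_all add: open_vimage[OF _ continuous_on_circle_exp])
  moreover have "circle_exp 1 -` U \<inter> circle_exp 1 -` V = {}"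
    using UV(5) by (simp flip: vimage_Int)
  ultimately show "\<exists>U V. open U \<and> open V \<and> s \<in> U \<and> t \<in> V \<and> U \<inter> V = {}"
    using UV(3,4) by (intro exI[of _ "circle_exp 1 -` U"] exI[of _ "circle_exp 1 -` V"]) simp
qed

definition circle_lebesgue :: "circle measure" where
  "circle_lebesgue = completion (distr (restrict_space lborel {0..<1}) borel to_circle)"

lemma measurable_to_circle: "to_circle \<in> restrict_space lborel {0..<1} \<rightarrow>\<^sub>M borel"
proof -
  have "to_circle \<in> borel \<rightarrow>\<^sub>M borel"
    by (rule borel_measurable_continuous_onI[OF continuous_on_to_circle])
  then show ?thesis
    by (intro measurable_restrict_space1) simp
qed

lemma prob_space_circle_lebesgue: "prob_space circle_lebesgue"
proof -
  have "prob_space (restrict_space lborel {0..<1::real})"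
    by (rule prob_spaceI) (simp add: emeasure_restrict_space space_restrict_space)
  then have "prob_space (distr (restrict_space lborel {0..<1}) borel to_circle)"
    by (rule prob_space.prob_space_distr[OF _ measurable_to_circle])
  then show ?thesis
    unfolding circle_lebesgue_def
    by (rule prob_space.prob_space_completion)
qed

(* The sign conventions differ: exp (2 pi i n x) for measures, exp (- 2 pi i n x) for
   functions. *)
definition measure_fourier :: "circle measure \<Rightarrow> int \<Rightarrow> complex" where
  "measure_fourier \<mu> n = (\<integral>x. circle_exp n x \<partial>\<mu>)"

definition fourier_coeff :: "(circle \<Rightarrow> complex) \<Rightarrow> int \<Rightarrow> complex" where
  "fourier_coeff f n = (\<integral>x. f x * circle_exp (- n) x \<partial>circle_lebesgue)"

(* Functions rather than almost-everywhere classes; the Fourier coefficients depend only on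
   the class. *)
definition circle_L2 :: "(circle \<Rightarrow> complex) set" where
  "circle_L2 = {f \<in> borel_measurable circle_lebesgue.
     integrable circle_lebesgue (\<lambda>x. (cmod (f x))\<^sup>2)}"

definition sobolev :: "real \<Rightarrow> (circle \<Rightarrow> complex) set" where
  "sobolev p = {f \<in> circle_L2.
     (\<lambda>n::int. (cmod (fourier_coeff f n))\<^sup>2 * (1 + (real_of_int n)\<^sup>2) powr p) summable_on UNIV}"

definition fourier_partial_sum :: "(circle \<Rightarrow> complex) \<Rightarrow> nat \<Rightarrow> circle \<Rightarrow> complex" where
  "fourier_partial_sum f N t = (\<Sum>n\<in>{- int N..int N}. fourier_coeff f n * circle_exp n t)"

end

theory Submission
  imports Defs
begin

text \<open>
  The proof combines a Schur test in \<open>L\<^sup>2(\<mu>)\<close> with a Rademacher-Menshov maximal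
  inequality on dyadic blocks of frequencies; the strict inequality \<open>p > (1 - a) / 2\<close> pays for
  the logarithms that this maximal inequality loses.

  The exponentials are not orthogonal in \<open>L\<^sup>2(\<mu>)\<close>, but the Gram matrix of the
  frequencies in \<open>[-L, L]\<close> has the entries \<open>\<mu>^(n - m)\<close>, and the decay of \<open>\<mu>^\<close> bounds its
  row sums, hence its norm, by a multiple of \<open>L\<close> to the power \<open>1 - a + \<delta>\<close>, for any
  \<open>\<delta> > 0\<close> (\<open>integral_exp_sum_le\<close>). On the other hand the frequencies
  \<open>2 ^ k \<le> \<bar>n\<bar> < 2 ^ (k + 1)\<close> contribute at most a multiple of \<open>2\<close> to the power
  \<open>- 2 p k\<close> to the sum \<open>\<Sum>\<bar>c n\<bar>\<^sup>2\<close> of the squared coefficients. With \<open>2 \<delta> = 2 p - (1 - a)\<close>, every piece of the \<open>k\<close>-th block is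
  therefore small in \<open>L\<^sup>2(\<mu>)\<close>, by a factor that decays geometrically in \<open>k\<close>.

  To control all partial sums of one block at the same point \<open>t\<close>, each of them is cut into
  at most one dyadic piece of every scale. Adding up the squares of all dyadic pieces gives a
  function of \<open>t\<close> that dominates every partial sum
  (\<open>partial_block_le_dyadic_energy\<close>) and whose integral costs only a factor polynomial in
  \<open>k\<close> (\<open>integral_dyadic_energy_le\<close>). So the block maxima are summable over \<open>k\<close> for almost
  every \<open>t\<close> (\<open>AE_summable_block_energy\<close>), and the symmetric partial sums converge there
  (\<open>convergent_of_summable_block_maxima\<close>).
\<close>

section \<open>A maximal inequality of Rademacher and Menshov\<close>

text \<open>
  This is the sum of the squared norms of the sums of \<open>x\<close> over all dyadic subintervals, of every
  length \<open>2 ^ j\<close> with \<open>j \<le> k\<close>, of the interval of length \<open>2 ^ k\<close> that starts at \<open>u\<close>. The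
  recursion splits the interval into its two halves.
\<close>
fun dyadic_energy :: "(nat \<Rightarrow> 'a::real_normed_vector) \<Rightarrow> nat \<Rightarrow> nat \<Rightarrow> real" where
  "dyadic_energy x 0 u = (norm (x u))\<^sup>2"
| "dyadic_energy x (Suc k) u =
     (norm (\<Sum>i\<in>{u..<u + 2 ^ Suc k}. x i))\<^sup>2 + dyadic_energy x k u + dyadic_energy x k (u + 2 ^ k)"

lemma dyadic_energy_nonneg: "0 \<le> dyadic_energy x k u"
  by (induction k arbitrary: u) auto

lemma full_block_le_dyadic_energy: "(norm (\<Sum>i\<in>{u..<u + 2 ^ k}. x i))\<^sup>2 \<le> dyadic_energy x k u"
  by (cases k) (auto simp: dyadic_energy_nonneg add_nonneg_nonneg)

text \<open>
  The weights are those for which the constant in the induction on the scale grows only by one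
  per scale.
\<close>
lemma square_add_le_weighted:
  fixes r s c :: real
  assumes "c > 0"
  shows "(r + s)\<^sup>2 \<le> (c + 1) * (r\<^sup>2 + s\<^sup>2 / c)"
proof -
  have "(c + 1) * (r\<^sup>2 + s\<^sup>2 / c) - (r + s)\<^sup>2 = (c * r - s)\<^sup>2 / c"
    using assms by (simp add: field_simps power2_eq_square)
  moreover have "(c * r - s)\<^sup>2 / c \<ge> 0" using assms by simp
  ultimately show ?thesis by linarith
qed

text \<open>
  An initial segment is a disjoint union of dyadic intervals with at most one of each length, so
  Cauchy-Schwarz loses only the number \<open>k + 1\<close> of scales. In the induction a segment
  either lies in the left half, or it is the left half together with an initial segment of the
  right half.
\<close>
lemma partial_block_le_dyadic_energy:
  fixes x :: "nat \<Rightarrow> 'a::real_normed_vector"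
  assumes "n \<le> 2 ^ k"
  shows "(norm (\<Sum>i\<in>{u..<u + n}. x i))\<^sup>2 \<le> (real k + 1) * dyadic_energy x k u"
  using assms
proof (induction k arbitrary: u n)
  case 0
  then have "n = 0 \<or> n = 1" by auto
  then show ?case by auto
next
  case (Suc k)
  show ?case
  proof (cases "n \<le> 2 ^ k")
    case True
    have "(norm (\<Sum>i\<in>{u..<u + n}. x i))\<^sup>2 \<le> (real k + 1) * dyadic_energy x k u"
      by (rule Suc.IH[OF True])
    also have "\<dots> \<le> (real (Suc k) + 1) * dyadic_energy x (Suc k) u"
      by (intro mult_mono) (auto simp: dyadic_energy_nonneg add_nonneg_nonneg)
    finally show ?thesis .
  next
    case False
    define m where "m = n - 2 ^ k"
    have m: "n = 2 ^ k + m" "m \<le> 2 ^ k" using False Suc.prems by (auto simp: m_def)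
    let ?h = "norm (\<Sum>i\<in>{u..<u + 2 ^ k}. x i)"
    let ?r = "norm (\<Sum>i\<in>{u + 2 ^ k..<u + 2 ^ k + m}. x i)"
    have "(\<Sum>i\<in>{u..<u + n}. x i)
        = (\<Sum>i\<in>{u..<u + 2 ^ k}. x i) + (\<Sum>i\<in>{u + 2 ^ k..<u + 2 ^ k + m}. x i)"
      by (subst sum.atLeastLessThan_concat) (auto simp: m(1) add.assoc)
    then have "(norm (\<Sum>i\<in>{u..<u + n}. x i))\<^sup>2 \<le> (?h + ?r)\<^sup>2"
      by (intro power_mono) (auto intro: norm_triangle_ineq)
    also have "\<dots> \<le> (real k + 1 + 1) * (?h\<^sup>2 + ?r\<^sup>2 / (real k + 1))"
      by (rule square_add_le_weighted) simp
    also have "\<dots> \<le> (real k + 1 + 1) * (dyadic_energy x k u + dyadic_energy x k (u + 2 ^ k))"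
    proof (intro mult_left_mono add_mono)
      show "?h\<^sup>2 \<le> dyadic_energy x k u" by (rule full_block_le_dyadic_energy)
      show "?r\<^sup>2 / (real k + 1) \<le> dyadic_energy x k (u + 2 ^ k)"
        using Suc.IH[OF m(2), of "u + 2 ^ k"] by (simp add: field_simps)
    qed simp
    also have "\<dots> \<le> (real (Suc k) + 1) * dyadic_energy x (Suc k) u"
      by (intro mult_mono) (auto simp: dyadic_energy_nonneg add_nonneg_nonneg)
    finally show ?thesis .
  qed
qed

text \<open>
  The dyadic intervals of one length tile the block, so each of the \<open>k + 1\<close> scales contributes at
  most \<open>A\<close> times the sum of \<open>e\<close> over the whole block.
\<close>
lemma integral_dyadic_energy_le:
  fixes x :: "nat \<Rightarrow> 'b \<Rightarrow> 'a::real_normed_vector"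
  assumes int: "\<And>u l. v \<le> u \<Longrightarrow> u + l \<le> w \<Longrightarrow>
                  integrable M (\<lambda>t. (norm (\<Sum>i\<in>{u..<u + l}. x i t))\<^sup>2)"
    and le: "\<And>u l. v \<le> u \<Longrightarrow> u + l \<le> w \<Longrightarrow>
                  (\<integral>t. (norm (\<Sum>i\<in>{u..<u + l}. x i t))\<^sup>2 \<partial>M) \<le> A * (\<Sum>i\<in>{u..<u + l}. e i)"
    and "v \<le> u" "u + 2 ^ k \<le> w"
  shows "integrable M (\<lambda>t. dyadic_energy (\<lambda>i. x i t) k u) \<and>
         (\<integral>t. dyadic_energy (\<lambda>i. x i t) k u \<partial>M) \<le> (real k + 1) * A * (\<Sum>i\<in>{u..<u + 2 ^ k}. e i)"
  using assms(3,4)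
proof (induction k arbitrary: u)
  case 0
  then show ?case using int[of u 1] le[of u 1] by simp
next
  case (Suc k)
  have 1: "v \<le> u + 2 ^ k" "u + 2 ^ k + 2 ^ k \<le> w" "u + 2 ^ k \<le> w" using Suc.prems by auto
  note I1 = Suc.IH[OF Suc.prems(1) 1(3)] and I2 = Suc.IH[OF 1(1,2)]
  note T = int[OF Suc.prems] le[OF Suc.prems]
  have s: "(\<Sum>i\<in>{u..<u + 2 ^ Suc k}. e i)
        = (\<Sum>i\<in>{u..<u + 2 ^ k}. e i) + (\<Sum>i\<in>{u + 2 ^ k..<u + 2 ^ k + 2 ^ k}. e i)"
    by (subst sum.atLeastLessThan_concat) (auto simp: mult_2 add.assoc)
  have "(\<integral>t. dyadic_energy (\<lambda>i. x i t) (Suc k) u \<partial>M)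
      = (\<integral>t. (norm (\<Sum>i\<in>{u..<u + 2 ^ Suc k}. x i t))\<^sup>2 \<partial>M)
      + (\<integral>t. dyadic_energy (\<lambda>i. x i t) k u \<partial>M) + (\<integral>t. dyadic_energy (\<lambda>i. x i t) k (u + 2 ^ k) \<partial>M)"
    using T(1) I1 I2 unfolding dyadic_energy.simps by (simp del: power_Suc)
  also have "\<dots> \<le> A * (\<Sum>i\<in>{u..<u + 2 ^ Suc k}. e i)
       + (real k + 1) * A * (\<Sum>i\<in>{u..<u + 2 ^ k}. e i)
       + (real k + 1) * A * (\<Sum>i\<in>{u + 2 ^ k..<u + 2 ^ k + 2 ^ k}. e i)"
    using T(2) I1 I2 by (intro add_mono) auto
  also have "\<dots> = (real (Suc k) + 1) * A * (\<Sum>i\<in>{u..<u + 2 ^ Suc k}. e i)"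
    unfolding s by (simp add: algebra_simps)
  finally show ?case using T(1) I1 I2 unfolding dyadic_energy.simps by (simp del: power_Suc)
qed

section \<open>Convergence from summable block maxima\<close>

text \<open>
  Along the powers of two the partial sums converge absolutely, and between two consecutive powers
  they move by at most the block maximum, which tends to zero.
\<close>
lemma convergent_of_summable_block_maxima:
  fixes x :: "nat \<Rightarrow> 'a::banach"
  assumes bound: "\<And>k n. n \<le> 2 ^ k \<Longrightarrow> norm (\<Sum>i\<in>{2 ^ k..<2 ^ k + n}. x i) \<le> b k"
    and "summable b"
  shows "convergent (\<lambda>N. \<Sum>i\<in>{1..<N}. x i)"
proof -
  define T where "T N = (\<Sum>i\<in>{1..<N}. x i)" for N
  have diff: "norm (T (2 ^ k + n) - T (2 ^ k)) \<le> b k" if "n \<le> 2 ^ k" for k n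
  proof -
    have "T (2 ^ k) + (\<Sum>i\<in>{2 ^ k..<2 ^ k + n}. x i) = T (2 ^ k + n)"
      unfolding T_def by (rule sum.atLeastLessThan_concat) auto
    then have "T (2 ^ k + n) - T (2 ^ k) = (\<Sum>i\<in>{2 ^ k..<2 ^ k + n}. x i)"
      by (simp add: algebra_simps)
    then show ?thesis using bound[OF that] by simp
  qed
  have "norm (T (2 ^ Suc k) - T (2 ^ k)) \<le> b k" for k
    using diff[of "2 ^ k" k] by (simp add: mult_2)
  then have "summable (\<lambda>k. T (2 ^ Suc k) - T (2 ^ k))"
    by (intro summable_comparison_test[OF _ \<open>summable b\<close>]) auto
  then have "convergent (\<lambda>k. \<Sum>j<k. (T (2 ^ Suc j) - T (2 ^ j)))"
    by (simp add: summable_iff_convergent)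
  then have "convergent (\<lambda>k. T (2 ^ k) - T 1)"
    by (subst (asm) sum_lessThan_telescope) simp
  then obtain l0 where "(\<lambda>k. T (2 ^ k) - T 1) \<longlonglongrightarrow> l0" by (auto simp: convergent_def)
  from tendsto_add[OF this tendsto_const[of "T 1"]]
  obtain l where l: "(\<lambda>k. T (2 ^ k)) \<longlonglongrightarrow> l" by auto
  have b0: "b \<longlonglongrightarrow> 0" using \<open>summable b\<close> by (rule summable_LIMSEQ_zero)
  have "T \<longlonglongrightarrow> l"
  proof (rule LIMSEQ_I)
    fix r :: real assume "r > 0"
    then have "r / 2 > 0" by simp
    obtain k1 where k1: "\<And>k. k \<ge> k1 \<Longrightarrow> norm (T (2 ^ k) - l) < r / 2"
      using LIMSEQ_D[OF l \<open>r / 2 > 0\<close>] by blast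
    obtain k2 where k2: "\<And>k. k \<ge> k2 \<Longrightarrow> norm (b k - 0) < r / 2"
      using LIMSEQ_D[OF b0 \<open>r / 2 > 0\<close>] by blast
    show "\<exists>N0. \<forall>N\<ge>N0. norm (T N - l) < r"
    proof (intro exI allI impI)
      fix N :: nat assume N: "N \<ge> 2 ^ max k1 k2"
      moreover have "(2::nat) ^ max k1 k2 \<ge> 1" by simp
      ultimately have "N \<ge> 1" by linarith
      then obtain k where k: "2 ^ k \<le> N" "N < 2 ^ (k + 1)" using ex_power_ivl1[of 2 N] by auto
      have "(2::nat) ^ max k1 k2 < 2 ^ (k + 1)" using N k(2) by linarith
      then have "max k1 k2 < k + 1" by (rule power_less_imp_less_exp[rotated]) simp
      then have kk: "k \<ge> k1" "k \<ge> k2" by auto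
      have "norm (T (2 ^ k + (N - 2 ^ k)) - T (2 ^ k)) \<le> b k" by (rule diff) (use k(2) in auto)
      then have "norm (T N - T (2 ^ k)) \<le> b k" using k(1) by simp
      moreover have "norm (T N - l) \<le> norm (T N - T (2 ^ k)) + norm (T (2 ^ k) - l)"
        using norm_triangle_ineq[of "T N - T (2 ^ k)" "T (2 ^ k) - l"] by simp
      ultimately show "norm (T N - l) < r" using k1[OF kk(1)] k2[OF kk(2)] by auto
    qed
  qed
  then show ?thesis unfolding T_def convergent_def by blast
qed

lemma AE_summable_of_summable_integral:
  fixes h :: "nat \<Rightarrow> 'b \<Rightarrow> real"
  assumes int: "\<And>k. integrable M (h k)" and nonneg: "\<And>k t. 0 \<le> h k t"
    and le: "\<And>k. (\<integral>t. h k t \<partial>M) \<le> b k" and "summable b"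
  shows "AE t in M. summable (\<lambda>k. h k t)"
proof -
  have [measurable]: "h k \<in> borel_measurable M" for k using int by auto
  have "summable (\<lambda>k. \<integral>t. h k t \<partial>M)"
    by (rule summable_comparison_test[OF _ \<open>summable b\<close>]) (auto simp: le nonneg)
  have "(\<integral>\<^sup>+t. (\<Sum>k. ennreal (h k t)) \<partial>M) = (\<Sum>k. \<integral>\<^sup>+t. ennreal (h k t) \<partial>M)"
    by (rule nn_integral_suminf) auto
  also have "\<dots> = (\<Sum>k. ennreal (\<integral>t. h k t \<partial>M))"
    using int nonneg by (simp add: nn_integral_eq_integral)
  also have "\<dots> \<noteq> \<infinity>"
    using \<open>summable (\<lambda>k. \<integral>t. h k t \<partial>M)\<close> by (simp add: suminf_ennreal2 nonneg)
  finally have "AE t in M. (\<Sum>k. ennreal (h k t)) \<noteq> \<infinity>"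
    by (intro nn_integral_noteq_infinite) auto
  then show ?thesis
    by eventually_elim (rule summable_suminf_not_top, auto simp: nonneg)
qed

text \<open>
  A bound on the second moments gives summability of the functions themselves: the inequality of
  arithmetic and geometric means bounds the square root of \<open>g\<close> by the mean of \<open>g / b\<close> and \<open>b\<close>,
  and the integral of \<open>g / b\<close> is at most \<open>b\<close>.
\<close>
lemma AE_summable_sqrt:
  fixes g :: "nat \<Rightarrow> 'b \<Rightarrow> real"
  assumes int: "\<And>k. integrable M (g k)" and nonneg: "\<And>k t. 0 \<le> g k t"
    and le: "\<And>k. (\<integral>t. g k t \<partial>M) \<le> (b k)\<^sup>2" and pos: "\<And>k. b k > 0" and "summable b"
  shows "AE t in M. summable (\<lambda>k. sqrt (g k t))"
proof -
  have "AE t in M. summable (\<lambda>k. g k t / b k)"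
  proof (rule AE_summable_of_summable_integral[OF _ _ _ \<open>summable b\<close>])
    show "(\<integral>t. g k t / b k \<partial>M) \<le> b k" for k
      using le[of k] pos[of k] int[of k] by (simp add: divide_le_eq power2_eq_square)
  qed (use int nonneg pos in \<open>auto intro!: divide_nonneg_pos\<close>)
  then show ?thesis
  proof eventually_elim
    case (elim t)
    have "sqrt (g k t) \<le> (g k t / b k + b k) / 2" for k
      using arith_geo_mean_sqrt[of "g k t / b k" "b k"] pos[of k] nonneg[of k t] by simp
    then show ?case
      using nonneg
      by (intro summable_comparison_test[OF _ summable_divide[OF summable_add[OF elim \<open>summable b\<close>], of 2]])
         auto
  qed
qed

section \<open>Exponential sums in the mean square\<close>

lemma norm_circle_exp [simp]: "cmod (circle_exp n t) = 1"
  by transfer (simp add: norm_exp_eq_Re)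

lemma circle_exp_mult_cnj: "circle_exp n t * cnj (circle_exp m t) = circle_exp (n - m) t"
  by transfer (simp add: exp_cnj mult_exp_exp algebra_simps)

lemma circle_exp_0 [simp]: "circle_exp 0 t = 1"
  by transfer simp

lemma borel_measurable_circle_exp:
  assumes "sets \<mu> = sets borel"
  shows "circle_exp n \<in> borel_measurable \<mu>"
proof -
  have "circle_exp n \<in> borel_measurable borel"
    by (rule borel_measurable_continuous_onI[OF continuous_on_circle_exp])
  then show ?thesis by (simp cong: measurable_cong_sets add: assms)
qed

text \<open>
  Schur's test: expanding the square gives the quadratic form of the Gram matrix with the entries
  \<open>\<mu>^(n - m)\<close>, and \<open>\<bar>c n\<bar> \<bar>c m\<bar> \<le> (\<bar>c n\<bar>\<^sup>2 + \<bar>c m\<bar>\<^sup>2) / 2\<close> reduces it to row and column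
  sums.
\<close>
lemma integral_exp_sum_le_schur:
  fixes c :: "int \<Rightarrow> complex" and \<kappa> :: "int \<Rightarrow> real"
  assumes "prob_space \<mu>" and sets: "sets \<mu> = sets borel" and "finite F"
    and \<kappa>: "\<And>m n. m \<in> F \<Longrightarrow> n \<in> F \<Longrightarrow> cmod (measure_fourier \<mu> (n - m)) \<le> \<kappa> (n - m)"
    and row: "\<And>n. n \<in> F \<Longrightarrow> (\<Sum>m\<in>F. \<kappa> (n - m)) \<le> A"
    and col: "\<And>m. m \<in> F \<Longrightarrow> (\<Sum>n\<in>F. \<kappa> (n - m)) \<le> A"
  shows "integrable \<mu> (\<lambda>t. (cmod (\<Sum>n\<in>F. c n * circle_exp n t))\<^sup>2)"
    and "(\<integral>t. (cmod (\<Sum>n\<in>F. c n * circle_exp n t))\<^sup>2 \<partial>\<mu>) \<le> A * (\<Sum>n\<in>F. (cmod (c n))\<^sup>2)"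
proof -
  interpret prob_space \<mu> by fact
  let ?P = "\<lambda>t. \<Sum>n\<in>F. c n * circle_exp n t"
  have ie: "integrable \<mu> (circle_exp n)" for n
    by (rule integrable_const_bound[where B = 1]) (auto simp: borel_measurable_circle_exp[OF sets])
  have expand: "complex_of_real ((cmod (?P t))\<^sup>2)
      = (\<Sum>n\<in>F. \<Sum>m\<in>F. c n * cnj (c m) * circle_exp (n - m) t)" for t
    unfolding complex_norm_square cnj_sum sum_product complex_cnj_mult circle_exp_mult_cnj[symmetric]
    by (simp add: mult_ac)
  have int: "integrable \<mu> (\<lambda>t. complex_of_real ((cmod (?P t))\<^sup>2))"
    unfolding expand using ie by simp
  then show "integrable \<mu> (\<lambda>t. (cmod (?P t))\<^sup>2)"
    by (simp only: complex_of_real_integrable_eq)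
  have "complex_of_real (\<integral>t. (cmod (?P t))\<^sup>2 \<partial>\<mu>) = (\<integral>t. complex_of_real ((cmod (?P t))\<^sup>2) \<partial>\<mu>)"
    by (rule integral_complex_of_real[symmetric])
  also have "\<dots> = (\<Sum>n\<in>F. \<Sum>m\<in>F. c n * cnj (c m) * measure_fourier \<mu> (n - m))"
    unfolding expand measure_fourier_def using ie by (simp add: Bochner_Integration.integral_sum)
  finally have "(\<integral>t. (cmod (?P t))\<^sup>2 \<partial>\<mu>)
      = Re (\<Sum>n\<in>F. \<Sum>m\<in>F. c n * cnj (c m) * measure_fourier \<mu> (n - m))"
    by (metis Re_complex_of_real)
  also have "\<dots> \<le> cmod (\<Sum>n\<in>F. \<Sum>m\<in>F. c n * cnj (c m) * measure_fourier \<mu> (n - m))"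
    by (rule complex_Re_le_cmod)
  also have "\<dots> \<le> (\<Sum>n\<in>F. \<Sum>m\<in>F. cmod (c n) * cmod (c m) * cmod (measure_fourier \<mu> (n - m)))"
    by (intro order_trans[OF norm_sum] sum_mono) (simp add: norm_mult)
  also have "\<dots> \<le> (\<Sum>n\<in>F. \<Sum>m\<in>F. ((cmod (c n))\<^sup>2 * \<kappa> (n - m) + (cmod (c m))\<^sup>2 * \<kappa> (n - m)) / 2)"
  proof (intro sum_mono)
    fix n m assume "n \<in> F" "m \<in> F"
    have "cmod (c n) * cmod (c m) * cmod (measure_fourier \<mu> (n - m))
        \<le> (((cmod (c n))\<^sup>2 + (cmod (c m))\<^sup>2) / 2) * \<kappa> (n - m)"
      using sum_squares_bound[of "cmod (c n)" "cmod (c m)"] \<kappa>[OF \<open>m \<in> F\<close> \<open>n \<in> F\<close>]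
      by (intro mult_mono) auto
    then show "cmod (c n) * cmod (c m) * cmod (measure_fourier \<mu> (n - m))
        \<le> ((cmod (c n))\<^sup>2 * \<kappa> (n - m) + (cmod (c m))\<^sup>2 * \<kappa> (n - m)) / 2"
      by (simp add: field_simps)
  qed
  also have "\<dots> = ((\<Sum>n\<in>F. (cmod (c n))\<^sup>2 * (\<Sum>m\<in>F. \<kappa> (n - m)))
                 + (\<Sum>m\<in>F. (cmod (c m))\<^sup>2 * (\<Sum>n\<in>F. \<kappa> (n - m)))) / 2"
    using sum.swap[of "\<lambda>n m. (cmod (c m))\<^sup>2 * \<kappa> (n - m)" F F]
    by (simp add: sum.distrib sum_distrib_left flip: sum_divide_distrib)
  also have "\<dots> \<le> ((\<Sum>n\<in>F. (cmod (c n))\<^sup>2 * A) + (\<Sum>m\<in>F. (cmod (c m))\<^sup>2 * A)) / 2"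
    using row col by (intro divide_right_mono add_mono sum_mono mult_left_mono) auto
  also have "\<dots> = A * (\<Sum>n\<in>F. (cmod (c n))\<^sup>2)"
    by (simp add: sum_distrib_left mult.commute)
  finally show "(\<integral>t. (cmod (?P t))\<^sup>2 \<partial>\<mu>) \<le> A * (\<Sum>n\<in>F. (cmod (c n))\<^sup>2)" .
qed

text \<open>
  The value 1 at \<open>j = 0\<close> accounts for the diagonal of the Gram matrix, where the power would be 0.
\<close>
lemma sum_int_powr_bounded:
  fixes \<delta> :: real
  assumes "\<delta> > 0"
  obtains Z where "\<And>J::int set. finite J \<Longrightarrow>
    (\<Sum>j\<in>J. if j = 0 then 1 else (real_of_int \<bar>j\<bar>) powr (- 1 - \<delta>)) \<le> Z"
proof -
  define g :: "int \<Rightarrow> real" where "g j = (if j = 0 then 1 else (real_of_int \<bar>j\<bar>) powr (- 1 - \<delta>))" for j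
  have "summable (\<lambda>i::nat. (real i) powr (- 1 - \<delta>))"
    using assms by (simp add: summable_real_powr_iff)
  then have s: "summable (\<lambda>i. g (int i))"
    by (rule summable_cong[THEN iffD1, rotated])
       (rule eventually_sequentiallyI[of 1], simp add: g_def)
  have nn: "g j \<ge> 0" for j by (simp add: g_def)
  have half: "(\<Sum>j\<in>J. g j) \<le> (\<Sum>i. g (int i))" if "finite J" "inj_on (\<lambda>j. nat \<bar>j\<bar>) J" for J
  proof -
    have "(\<Sum>j\<in>J. g j) = (\<Sum>i\<in>(\<lambda>j. nat \<bar>j\<bar>) ` J. g (int i))"
      by (subst sum.reindex[OF that(2)]) (auto simp: g_def intro!: sum.cong)
    also have "\<dots> \<le> (\<Sum>i. g (int i))" using that s nn by (intro sum_le_suminf) auto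
    finally show ?thesis .
  qed
  show ?thesis
  proof (rule that[of "2 * (\<Sum>i. g (int i))"], fold g_def)
    fix J :: "int set" assume "finite J"
    have "(\<Sum>j\<in>J. g j) = (\<Sum>j\<in>J \<inter> {0..}. g j) + (\<Sum>j\<in>J - {0..}. g j)"
      using \<open>finite J\<close> by (rule sum.Int_Diff)
    also have "\<dots> \<le> (\<Sum>i. g (int i)) + (\<Sum>i. g (int i))"
      using \<open>finite J\<close> by (intro add_mono half) (auto simp: inj_on_def)
    finally show "(\<Sum>j\<in>J. g j) \<le> 2 * (\<Sum>i. g (int i))" by simp
  qed
qed

text \<open>
  The decay \<open>\<bar>j\<bar> powr (- a)\<close> is not summable. But the differences \<open>j\<close> of frequencies are at most
  \<open>2 L\<close>, and factoring it as \<open>\<bar>j\<bar> powr (1 - a + \<delta>) * \<bar>j\<bar> powr (- 1 - \<delta>)\<close> moves the excess into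
  the power of \<open>L\<close>. The loss \<open>\<delta>\<close> covers the logarithm that
  would appear for \<open>a = 1\<close>.
\<close>
lemma integral_exp_sum_le:
  fixes a K \<delta> :: real
  assumes "prob_space \<mu>" and sets: "sets \<mu> = sets borel" and "K > 0" and "a \<le> 1" and "\<delta> > 0"
    and decay: "\<And>n::int. n \<noteq> 0 \<Longrightarrow> cmod (measure_fourier \<mu> n) \<le> K * (real_of_int \<bar>n\<bar>) powr (- a)"
  shows "\<exists>C>0. \<forall>c F L. L \<ge> 1 \<longrightarrow> F \<subseteq> {- int L..int L} \<longrightarrow>
           integrable \<mu> (\<lambda>t. (cmod (\<Sum>n\<in>F. c n * circle_exp n t))\<^sup>2) \<and>
           (\<integral>t. (cmod (\<Sum>n\<in>F. c n * circle_exp n t))\<^sup>2 \<partial>\<mu>)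
             \<le> C * (real L) powr (1 - a + \<delta>) * (\<Sum>n\<in>F. (cmod (c n))\<^sup>2)"
proof -
  interpret prob_space \<mu> by fact
  define g :: "int \<Rightarrow> real" where "g j = (if j = 0 then 1 else (real_of_int \<bar>j\<bar>) powr (- 1 - \<delta>))" for j
  obtain Z where Z: "\<And>J. finite J \<Longrightarrow> (\<Sum>j\<in>J. g j) \<le> Z"
    using sum_int_powr_bounded[OF \<open>\<delta> > 0\<close>] unfolding g_def by blast
  have "Z \<ge> 1" using Z[of "{0}"] by (simp add: g_def)
  define s where "s = 1 - a + \<delta>"
  have "s \<ge> 0" using assms by (simp add: s_def)
  define B where "B = (1 + K) * 2 powr s"
  have "B > 0" using \<open>K > 0\<close> by (simp add: B_def)
  show ?thesis
    unfolding s_def[symmetric]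
  proof (intro exI[of _ "B * Z"] conjI[of "B * Z > 0"] allI impI)
    show "B * Z > 0" using \<open>B > 0\<close> \<open>Z \<ge> 1\<close> by simp
    fix c :: "int \<Rightarrow> complex" and F :: "int set" and L :: nat
    assume L: "L \<ge> 1" and F: "F \<subseteq> {- int L..int L}"
    have "finite F" using F by (rule finite_subset) simp
    define \<kappa> where "\<kappa> j = B * real L powr s * g j" for j
    have BL: "B * real L powr s = (1 + K) * (2 * real L) powr s"
      by (simp add: B_def powr_mult)
    have \<kappa>: "cmod (measure_fourier \<mu> (n - m)) \<le> \<kappa> (n - m)" if "m \<in> F" "n \<in> F" for m n
    proof (cases "n = m")
      case True
      have "(2 * real L) powr s \<ge> 1" using L \<open>s \<ge> 0\<close> by (intro ge_one_powr_ge_zero) auto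
      then have "1 * 1 \<le> (1 + K) * (2 * real L) powr s" using \<open>K > 0\<close> by (intro mult_mono) auto
      then show ?thesis using True BL by (simp add: \<kappa>_def measure_fourier_def g_def prob_space)
    next
      case False
      define j where "j = n - m"
      have "\<bar>m\<bar> \<le> int L" "\<bar>n\<bar> \<le> int L" using that F by (auto simp: abs_le_iff)
      then have j: "j \<noteq> 0" "\<bar>j\<bar> \<le> 2 * int L" using False by (auto simp: j_def)
      then have j': "real_of_int \<bar>j\<bar> \<le> 2 * real L" by linarith
      have "cmod (measure_fourier \<mu> j) \<le> K * (real_of_int \<bar>j\<bar>) powr (- a)"
        by (rule decay[OF j(1)])
      also have "(real_of_int \<bar>j\<bar>) powr (- a) = (real_of_int \<bar>j\<bar>) powr s * g j"
        using j(1) by (simp add: g_def s_def flip: powr_add)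
      also have "K * ((real_of_int \<bar>j\<bar>) powr s * g j) \<le> (1 + K) * ((2 * real L) powr s * g j)"
        using \<open>K > 0\<close> j' \<open>s \<ge> 0\<close>
        by (intro mult_mono powr_mono2) (auto simp: g_def)
      also have "\<dots> = \<kappa> j" unfolding \<kappa>_def BL by simp
      finally show ?thesis by (simp add: j_def)
    qed
    have row: "(\<Sum>m\<in>F. \<kappa> (n - m)) \<le> B * Z * real L powr s" for n
    proof -
      have "(\<Sum>m\<in>F. g (n - m)) = sum g ((\<lambda>m. n - m) ` F)"
        by (subst sum.reindex) (auto simp: inj_on_def)
      also have "\<dots> \<le> Z" using \<open>finite F\<close> by (intro Z) auto
      finally have "B * real L powr s * (\<Sum>m\<in>F. g (n - m)) \<le> B * real L powr s * Z"
        using \<open>B > 0\<close> by (intro mult_left_mono) auto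
      then show ?thesis by (simp add: \<kappa>_def sum_distrib_left mult_ac)
    qed
    have col: "(\<Sum>n\<in>F. \<kappa> (n - m)) \<le> B * Z * real L powr s" for m
    proof -
      have "(\<Sum>n\<in>F. g (n - m)) = sum g ((\<lambda>n. n - m) ` F)"
        by (subst sum.reindex) (auto simp: inj_on_def)
      also have "\<dots> \<le> Z" using \<open>finite F\<close> by (intro Z) auto
      finally have "B * real L powr s * (\<Sum>n\<in>F. g (n - m)) \<le> B * real L powr s * Z"
        using \<open>B > 0\<close> by (intro mult_left_mono) auto
      then show ?thesis by (simp add: \<kappa>_def sum_distrib_left mult_ac)
    qed
    note schur = integral_exp_sum_le_schur[OF \<open>prob_space \<mu>\<close> sets \<open>finite F\<close>, of \<kappa>, OF \<kappa> row col]
    show "integrable \<mu> (\<lambda>t. (cmod (\<Sum>n\<in>F. c n * circle_exp n t))\<^sup>2) \<and>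
           (\<integral>t. (cmod (\<Sum>n\<in>F. c n * circle_exp n t))\<^sup>2 \<partial>\<mu>)
             \<le> B * Z * (real L) powr s * (\<Sum>n\<in>F. (cmod (c n))\<^sup>2)"
      using schur[of c] by blast
  qed
qed

section \<open>Almost everywhere convergence\<close>

text \<open>
  Pairing \<open>n\<close> with \<open>- n\<close> turns symmetric partial sums into partial sums over natural numbers. The
  index 0 is excluded, since it would be counted twice.
\<close>
lemma sum_symmetric_block:
  fixes h :: "int \<Rightarrow> 'a::comm_monoid_add"
  assumes "u \<ge> 1"
  shows "(\<Sum>n | int u \<le> \<bar>n\<bar> \<and> \<bar>n\<bar> < int v. h n) = (\<Sum>i\<in>{u..<v}. h (int i) + h (- int i))"
proof -
  have "{n. int u \<le> \<bar>n\<bar> \<and> \<bar>n\<bar> < int v} = int ` {u..<v} \<union> (\<lambda>i. - int i) ` {u..<v}"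
  proof (intro set_eqI iffI)
    fix n assume "n \<in> {n. int u \<le> \<bar>n\<bar> \<and> \<bar>n\<bar> < int v}"
    then have "nat \<bar>n\<bar> \<in> {u..<v}" "n = int (nat \<bar>n\<bar>) \<or> n = - int (nat \<bar>n\<bar>)" by auto
    then show "n \<in> int ` {u..<v} \<union> (\<lambda>i. - int i) ` {u..<v}" by blast
  qed auto
  moreover have "int ` {u..<v} \<inter> (\<lambda>i. - int i) ` {u..<v} = {}" using assms by auto
  ultimately show ?thesis
    by (simp add: sum.union_disjoint sum.reindex inj_on_def sum.distrib)
qed

lemma fourier_partial_sum_eq:
  "fourier_partial_sum f N t = fourier_coeff f 0
     + (\<Sum>i\<in>{1..<Suc N}. fourier_coeff f (int i) * circle_exp (int i) t
                        + fourier_coeff f (- int i) * circle_exp (- int i) t)"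
proof -
  let ?h = "\<lambda>n. fourier_coeff f n * circle_exp n t"
  have "{- int N..int N} = insert 0 {n. int 1 \<le> \<bar>n\<bar> \<and> \<bar>n\<bar> < int (Suc N)}" by auto
  moreover have "finite {n. int 1 \<le> \<bar>n\<bar> \<and> \<bar>n\<bar> < int (Suc N)}"
    by (rule finite_subset[of _ "{- int N..int N}"]) auto
  ultimately have "fourier_partial_sum f N t = ?h 0 + (\<Sum>n | int 1 \<le> \<bar>n\<bar> \<and> \<bar>n\<bar> < int (Suc N). ?h n)"
    unfolding fourier_partial_sum_def by simp
  then show ?thesis by (subst (asm) sum_symmetric_block) simp_all
qed

text \<open>
  In the \<open>k\<close>-th block the Gram matrix has norm at most of order \<open>2 powr (k (2 p - \<delta>))\<close>, and the
  Sobolev condition leaves at most \<open>2 powr (- 2 p k)\<close> for the squared coefficients; the product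
  \<open>2 powr (- \<delta> k)\<close> absorbs the factor \<open>(k + 1)\<^sup>2\<close> from the maximal inequality.
\<close>
lemma AE_summable_block_energy:
  fixes a K p :: real and c :: "int \<Rightarrow> complex"
  assumes "prob_space \<mu>" and "sets \<mu> = sets borel" and "K > 0" and "a \<le> 1"
    and "\<And>n::int. n \<noteq> 0 \<Longrightarrow> cmod (measure_fourier \<mu> n) \<le> K * (real_of_int \<bar>n\<bar>) powr (- a)"
    and "p > (1 - a) / 2"
    and sob: "(\<lambda>n::int. (cmod (c n))\<^sup>2 * (1 + (real_of_int n)\<^sup>2) powr p) summable_on UNIV"
  shows "AE t in \<mu>. summable (\<lambda>k. sqrt ((real k + 1) *
    dyadic_energy (\<lambda>i. c (int i) * circle_exp (int i) t + c (- int i) * circle_exp (- int i) t) k (2 ^ k)))"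
proof -
  define \<delta> where "\<delta> = (2 * p - (1 - a)) / 2"
  have "\<delta> > 0" using assms(6) by (simp add: \<delta>_def field_simps)
  define s where "s = 1 - a + \<delta>"
  have sd: "s = 2 * p - \<delta>" "s > 0" "p > 0"
    using assms(4,6) \<open>\<delta> > 0\<close> by (auto simp: s_def \<delta>_def field_simps)
  obtain C where "C > 0"
    and C: "\<And>c F L. L \<ge> 1 \<Longrightarrow> F \<subseteq> {- int L..int L} \<Longrightarrow>
           integrable \<mu> (\<lambda>t. (cmod (\<Sum>n\<in>F. c n * circle_exp n t))\<^sup>2) \<and>
           (\<integral>t. (cmod (\<Sum>n\<in>F. c n * circle_exp n t))\<^sup>2 \<partial>\<mu>)
             \<le> C * (real L) powr s * (\<Sum>n\<in>F. (cmod (c n))\<^sup>2)"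
    using integral_exp_sum_le[OF assms(1-4) \<open>\<delta> > 0\<close> assms(5), folded s_def] by auto
  define x where "x i t = c (int i) * circle_exp (int i) t + c (- int i) * circle_exp (- int i) t"
    for i :: nat and t
  define e where "e i = (cmod (c (int i)))\<^sup>2 + (cmod (c (- int i)))\<^sup>2" for i :: nat
  define S where "S = (\<Sum>\<^sub>\<infinity>n. (cmod (c n))\<^sup>2 * (1 + (real_of_int n)\<^sup>2) powr p)"
  have "S \<ge> 0" unfolding S_def by (intro infsum_nonneg) auto
  have xsum: "(\<Sum>i\<in>{u..<v}. x i t) = (\<Sum>n | int u \<le> \<bar>n\<bar> \<and> \<bar>n\<bar> < int v. c n * circle_exp n t)"
    and esum: "(\<Sum>i\<in>{u..<v}. e i) = (\<Sum>n | int u \<le> \<bar>n\<bar> \<and> \<bar>n\<bar> < int v. (cmod (c n))\<^sup>2)"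
    if "u \<ge> 1" for u v t
    unfolding x_def e_def by (simp_all add: sum_symmetric_block[OF that])
  have energy: "integrable \<mu> (\<lambda>t. dyadic_energy (\<lambda>i. x i t) k (2 ^ k)) \<and>
      (\<integral>t. dyadic_energy (\<lambda>i. x i t) k (2 ^ k) \<partial>\<mu>)
        \<le> (real k + 1) * (C * real (2 ^ Suc k) powr s) * (\<Sum>i\<in>{2 ^ k..<2 ^ k + 2 ^ k}. e i)" for k
  proof (rule integral_dyadic_energy_le[where v = "2 ^ k" and w = "2 ^ Suc k"])
    fix u l :: nat assume ul: "2 ^ k \<le> u" "u + l \<le> 2 ^ Suc k"
    have "u \<ge> 1" using ul(1) by (meson one_le_numeral one_le_power order_trans)
    have sub: "{n. int u \<le> \<bar>n\<bar> \<and> \<bar>n\<bar> < int (u + l)} \<subseteq> {- int (2 ^ Suc k)..int (2 ^ Suc k)}"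
    proof
      fix n assume "n \<in> {n. int u \<le> \<bar>n\<bar> \<and> \<bar>n\<bar> < int (u + l)}"
      then have "\<bar>n\<bar> \<le> int (2 ^ Suc k)"
        using ul(2)[folded of_nat_le_iff[where 'a = int]] by simp
      then show "n \<in> {- int (2 ^ Suc k)..int (2 ^ Suc k)}" unfolding abs_le_iff by simp
    qed
    note * = C[OF _ sub, of c, folded xsum[OF \<open>u \<ge> 1\<close>] esum[OF \<open>u \<ge> 1\<close>]]
    show "integrable \<mu> (\<lambda>t. (norm (\<Sum>i\<in>{u..<u + l}. x i t))\<^sup>2)"
      and "(\<integral>t. (norm (\<Sum>i\<in>{u..<u + l}. x i t))\<^sup>2 \<partial>\<mu>)
             \<le> C * real (2 ^ Suc k) powr s * (\<Sum>i\<in>{u..<u + l}. e i)"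
      using * by (auto simp del: power_Suc)
  qed auto
  have block: "(\<Sum>i\<in>{2 ^ k..<2 ^ k + 2 ^ k}. e i) \<le> S * (2 powr (- real k * (2 * p)))" for k :: nat
  proof -
    let ?F = "{n. int (2 ^ k) \<le> \<bar>n\<bar> \<and> \<bar>n\<bar> < int (2 ^ k + 2 ^ k)}"
    have "finite ?F" by (rule finite_subset[of _ "{- int (2 ^ k + 2 ^ k)..int (2 ^ k + 2 ^ k)}"]) auto
    have "(cmod (c n))\<^sup>2 * 2 powr (real k * (2 * p)) \<le> (cmod (c n))\<^sup>2 * (1 + (real_of_int n)\<^sup>2) powr p"
      if "n \<in> ?F" for n
    proof (intro mult_left_mono)
      have "real_of_int (int (2 ^ k)) \<le> real_of_int \<bar>n\<bar>"
        using that by (subst of_int_le_iff) simp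
      then have "2 ^ k \<le> \<bar>real_of_int n\<bar>" by simp
      then have "((2::real) ^ k)\<^sup>2 \<le> \<bar>real_of_int n\<bar>\<^sup>2" by (intro power_mono) auto
      then have "((2::real) ^ k)\<^sup>2 \<le> 1 + (real_of_int n)\<^sup>2" by simp
      then have "(((2::real) ^ k)\<^sup>2) powr p \<le> (1 + (real_of_int n)\<^sup>2) powr p"
        using sd by (intro powr_mono2) auto
      also have "((2::real) ^ k)\<^sup>2 = 2 powr (real k * 2)"
        using powr_realpow[of 2 "k * 2"] by (simp add: power_mult)
      also have "(2 powr (real k * 2)) powr p = 2 powr (real k * (2 * p))"
        by (simp add: powr_powr mult_ac)
      finally show "2 powr (real k * (2 * p)) \<le> (1 + (real_of_int n)\<^sup>2) powr p" .
    qed auto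
    then have "(\<Sum>n\<in>?F. (cmod (c n))\<^sup>2 * 2 powr (real k * (2 * p)))
        \<le> (\<Sum>n\<in>?F. (cmod (c n))\<^sup>2 * (1 + (real_of_int n)\<^sup>2) powr p)"
      by (rule sum_mono)
    also have "\<dots> \<le> S"
      unfolding S_def using \<open>finite ?F\<close> sob by (intro finite_sum_le_infsum) auto
    finally have "(\<Sum>i\<in>{2 ^ k..<2 ^ k + 2 ^ k}. e i) * 2 powr (real k * (2 * p)) \<le> S"
      by (subst esum) (auto simp: sum_distrib_right)
    then show ?thesis by (simp add: powr_minus field_simps)
  qed
  \<comment> \<open>The summand 1 makes \<open>R\<close> positive even if all coefficients vanish.\<close>
  define R where "R = sqrt (C * 2 powr s * S + 1)"
  have R2: "R\<^sup>2 = C * 2 powr s * S + 1" "R > 0"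
    using \<open>C > 0\<close> \<open>S \<ge> 0\<close> by (auto simp: R_def add_nonneg_pos)
  define b where "b k = R * ((real k + 1) * (2 powr (- \<delta> / 2)) ^ k)" for k :: nat
  have "AE t in \<mu>. summable (\<lambda>k. sqrt ((real k + 1) * dyadic_energy (\<lambda>i. x i t) k (2 ^ k)))"
  proof (rule AE_summable_sqrt[where b = b])
    show "b k > 0" for k using R2 by (simp add: b_def)
    have "2 powr (- \<delta> / 2) < (1::real)" using \<open>\<delta> > 0\<close> by (simp add: powr_less_one)
    then have "summable (\<lambda>k. real (Suc k) * (2 powr (- \<delta> / 2)) ^ k)"
      by (intro sums_summable[OF geometric_deriv_sums]) simp
    then show "summable b" unfolding b_def by (intro summable_mult) (simp add: add.commute)
    show "(\<integral>t. (real k + 1) * dyadic_energy (\<lambda>i. x i t) k (2 ^ k) \<partial>\<mu>) \<le> (b k)\<^sup>2" for k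
    proof -
      have "(\<integral>t. (real k + 1) * dyadic_energy (\<lambda>i. x i t) k (2 ^ k) \<partial>\<mu>)
          = (real k + 1) * (\<integral>t. dyadic_energy (\<lambda>i. x i t) k (2 ^ k) \<partial>\<mu>)"
        by simp
      also have "\<dots> \<le> (real k + 1) * ((real k + 1) * (C * real (2 ^ Suc k) powr s)
                      * (\<Sum>i\<in>{2 ^ k..<2 ^ k + 2 ^ k}. e i))"
        using energy[of k] by (intro mult_left_mono) auto
      also have "\<dots> \<le> (real k + 1) * ((real k + 1) * (C * real (2 ^ Suc k) powr s)
                      * (S * (2 powr (- real k * (2 * p)))))"
        using \<open>C > 0\<close> by (intro mult_left_mono block) auto
      also have "real (2 ^ Suc k) powr s = 2 powr s * 2 powr (real k * s)"
      proof -
        have "real (2 ^ Suc k) = 2 * 2 powr (real k)" by (simp add: powr_realpow)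
        then show ?thesis by (simp only: powr_mult powr_powr)
      qed
      also have "(real k + 1) * ((real k + 1) * (C * (2 powr s * 2 powr (real k * s)))
                      * (S * (2 powr (- real k * (2 * p)))))
          = (real k + 1)\<^sup>2 * (C * 2 powr s * S) * (2 powr (real k * s) * 2 powr (- real k * (2 * p)))"
        by (simp add: power2_eq_square mult_ac)
      also have "2 powr (real k * s) * 2 powr (- real k * (2 * p)) = (2::real) powr (- \<delta> * real k)"
        unfolding sd(1) by (simp add: algebra_simps flip: powr_add)
      also have "(real k + 1)\<^sup>2 * (C * 2 powr s * S) * 2 powr (- \<delta> * real k)
          \<le> (real k + 1)\<^sup>2 * R\<^sup>2 * 2 powr (- \<delta> * real k)"
        unfolding R2 by (intro mult_right_mono mult_left_mono) auto
      also have "2 powr (- \<delta> * real k) = ((2 powr (- \<delta> / 2)) ^ k)\<^sup>2"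
        by (simp add: powr_power mult.commute)
      finally show ?thesis by (simp add: b_def power_mult_distrib mult_ac)
    qed
    show "0 \<le> (real k + 1) * dyadic_energy (\<lambda>i. x i t) k (2 ^ k)" for k t
      by (intro mult_nonneg_nonneg dyadic_energy_nonneg) simp
  qed (use energy in simp)
  then show ?thesis unfolding x_def .
qed

theorem mainTheorem7:
  fixes a K p :: real and E :: "circle set" and \<mu> :: "circle measure"
    and f :: "circle \<Rightarrow> complex"
  assumes "0 \<le> a" and "a \<le> 1"
    and "compact E"
    and "emeasure circle_lebesgue E = 0"
    and "prob_space \<mu>" and "sets \<mu> = sets borel"
    and "emeasure \<mu> (- E) = 0"
    and "K > 0"
    and "\<And>n::int. n \<noteq> 0 \<Longrightarrow>
           cmod (measure_fourier \<mu> n) \<le> K * (real_of_int \<bar>n\<bar>) powr (- a)"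
    and "p > (1 - a) / 2"
    and "f \<in> sobolev p"
  shows "AE t in \<mu>. t \<in> E \<longrightarrow> convergent (\<lambda>N. fourier_partial_sum f N t)"
proof -
  let ?x = "\<lambda>t i. fourier_coeff f (int i) * circle_exp (int i) t
                  + fourier_coeff f (- int i) * circle_exp (- int i) t"
  have "AE t in \<mu>. summable (\<lambda>k. sqrt ((real k + 1) * dyadic_energy (?x t) k (2 ^ k)))"
    using assms(11) by (intro AE_summable_block_energy[OF assms(5,6,8,2,9,10)]) (auto simp: sobolev_def)
  then show ?thesis
  proof eventually_elim
    case (elim t)
    have "convergent (\<lambda>N. \<Sum>i\<in>{1..<N}. ?x t i)"
      by (rule convergent_of_summable_block_maxima[OF _ elim])
         (rule real_le_rsqrt, rule partial_block_le_dyadic_energy)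
    then have "convergent (\<lambda>N. \<Sum>i\<in>{1..<Suc N}. ?x t i)"
      by (rule convergent_Suc_iff[THEN iffD2])
    then show ?case
      unfolding fourier_partial_sum_eq by (simp add: convergent_add_const_iff del: sum.op_ivl_Suc)
  qed
qed

end
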